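(* Let $a$ be a real number with $0\le a<1$ and let $p$ be a prime number. Then the set of real numbers $\alpha$ such that $$\liminf_{q\to+\infty}\, q\,(\log q)^{2-a}\,\|q\alpha\|\,|q|_p\,\bigl(\log(2/|q|_p)\bigr)^a>0$$ (where $q$ runs over positive integers) has Hausdorff dimension $1$.
   Context: For a real number $x$, $\|x\|$ denotes the distance from $x$ to the nearest integer. For a prime $p$, $|\cdot|_p$ is the $p$-adic absolute value normalized so that $|p|_p=p^{-1}$. *)

theory Defs
  imports "HOL-Analysis.Analysis" "HOL-Computational_Algebra.Computational_Algebra"
begin

definition dist_nint :: "real \<Rightarrow> real" where
  "dist_nint x = \<bar>x - of_int (round x)\<bar>"

definition padic_abs :: "nat \<Rightarrow> int \<Rightarrow> real" where
  "padic_abs p q = (if q = 0 then 0 else real p powr (- real (multiplicity (int p) q)))"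

definition hausdorff_pre :: "real \<Rightarrow> real \<Rightarrow> 'a::metric_space set \<Rightarrow> ennreal" where
  "hausdorff_pre s \<delta> E =
     (INF C \<in> {C :: nat \<Rightarrow> 'a set. (\<forall>i. bounded (C i) \<and> diameter (C i) \<le> \<delta>) \<and> E \<subseteq> (\<Union>i. C i)}.
        (\<Sum>i. ennreal (diameter (C i) powr s)))"

definition hausdorff_measure :: "real \<Rightarrow> 'a::metric_space set \<Rightarrow> ennreal" where
  "hausdorff_measure s E = (SUP \<delta> \<in> {0<..}. hausdorff_pre s \<delta> E)"

definition hausdorff_dim :: "'a::metric_space set \<Rightarrow> ereal" where
  "hausdorff_dim E = Inf {ereal s | s. s > 0 \<and> hausdorff_measure s E = 0}"

end

theory Submission
  imports Defs "HOL-Real_Asymp.Real_Asymp"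
begin

text \<open>
  Write the quantity in question as \<open>w q * dist_nint (q * \<alpha>)\<close>. It must be shown that for a small
  \<open>c > 0\<close> the points \<open>\<alpha>\<close> outside all intervals of radius \<open>c / (q * w q)\<close> around the fractions \<open>b / q\<close>,
  \<open>q\<close> large, form a set of full dimension. The measure of these intervals sums to infinity over all
  \<open>q\<close>, but over each block \<open>L \<le> q < L ^ 3\<close> it is \<open>O(c)\<close>, uniformly in \<open>L\<close>. Following Peres and
  Schlag, take \<open>L\<^sub>t = N ^ (3 ^ t)\<close>. A cell of length \<open>1 / L\<^sub>t\<close> sees the fractions with denominator in
  block \<open>t\<close> equidistributed, so a proportion \<open>O(c)\<close> of its subcells of length \<open>1 / L\<^sub>t\<^sub>+\<^sub>2\<close> is
  dangerous. Looking one generation ahead one obtains a Cantor set in which every cell keeps half of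
  its children. The halving costs only a factor \<open>2 ^ t\<close>, negligible against \<open>L\<^sub>t\<close>, which grows doubly
  exponentially, so the dimension is 1.
\<close>

subsection \<open>Hausdorff measures on the line\<close>

lemma hausdorff_measure_mono:
  assumes "A \<subseteq> B"
  shows "hausdorff_measure s A \<le> hausdorff_measure s B"
  unfolding hausdorff_measure_def hausdorff_pre_def
  using assms by (intro SUP_mono' INF_superset_mono) auto

text \<open>The harmonic series diverges while the series of \<open>i powr -s\<close> converges for
  \<open>s > 1\<close>. Consecutive intervals of lengths proportional to \<open>1 / (i + 1)\<close>
  therefore cover the whole line at once, with arbitrarily small sum of \<open>s\<close>-th
  powers.\<close>

lemma hausdorff_measure_real_eq_0:
  fixes E :: "real set"
  assumes s: "s > 1"
  shows "hausdorff_measure s E = 0"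
proof -
  define H where "H n = (\<Sum>i<n. 1 / real (Suc i))" for n
  have H_mono: "H n \<le> H (Suc n)" for n by (simp add: H_def)
  have H_unbounded: "\<exists>n. y < H n" for y
  proof (rule ccontr)
    assume "\<nexists>n. y < H n"
    then have "summable (\<lambda>i. 1 / real (Suc i))"
      by (intro summableI_nonneg_bounded[where x = y]) (auto simp: H_def not_less)
    then show False
      using not_summable_harmonic[where 'a = real] summable_Suc_iff[of "\<lambda>i. 1 / real i"]
      by (simp add: inverse_eq_divide)
  qed
  have H_between: "\<exists>i. H i \<le> y \<and> y \<le> H (Suc i)" if "y \<ge> 0" for y
  proof -
    define n where "n = (LEAST n. y < H n)"
    have n: "y < H n" unfolding n_def using H_unbounded by (rule LeastI_ex)
    have "n \<noteq> 0" using n that by (auto simp: H_def intro: ccontr)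
    then obtain i where i: "n = Suc i" using not0_implies_Suc by blast
    have "\<not> y < H i" using not_less_Least[of i "\<lambda>n. y < H n"] i n_def by simp
    then show ?thesis using n i by (intro exI[of _ i]) auto
  qed
  define Z where "Z = (\<Sum>i. real (Suc i) powr - s)"
  have summ: "summable (\<lambda>i. real (Suc i) powr - s)"
    using s summable_real_powr_iff[of "-s"] summable_Suc_iff[of "\<lambda>i. real i powr - s"] by simp
  have small: "hausdorff_pre s \<delta> E \<le> ennreal (\<epsilon> powr s * Z)"
    if \<epsilon>: "0 < \<epsilon>" "\<epsilon> \<le> \<delta>" for \<delta> \<epsilon>
  proof -
    \<comment> \<open>Even indices cover the nonnegative half-line and odd ones its mirror image.
      Since each harmonic step occurs twice, the factor \<open>\<epsilon> / 2\<close> is what gives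
      the diameter bound \<open>\<epsilon> / (i + 1)\<close>.\<close>
    define D where "D i = {\<epsilon> / 2 * H (i div 2) .. \<epsilon> / 2 * H (Suc (i div 2))}" for i
    define C where "C i = (if even i then D i else uminus ` D i)" for i
    have diam: "diameter (C i) \<le> \<epsilon> / real (Suc i)" "bounded (C i)" for i
    proof -
      have "C i = {\<epsilon> / 2 * H (i div 2) .. \<epsilon> / 2 * H (Suc (i div 2))} \<or>
            C i = {- (\<epsilon> / 2 * H (Suc (i div 2))) .. - (\<epsilon> / 2 * H (i div 2))}"
        by (auto simp: C_def D_def)
      moreover have "\<epsilon> / 2 * H (i div 2) \<le> \<epsilon> / 2 * H (Suc (i div 2))"
        using \<epsilon> H_mono by simp
      ultimately have "diameter (C i) = \<epsilon> / 2 * H (Suc (i div 2)) - \<epsilon> / 2 * H (i div 2)" "bounded (C i)"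
        by auto
      moreover have "\<epsilon> / 2 * H (Suc (i div 2)) - \<epsilon> / 2 * H (i div 2) = \<epsilon> / (2 * real (Suc (i div 2)))" by (simp add: H_def field_simps)
      moreover have "Suc i \<le> 2 * Suc (i div 2)" by presburger
      then have "real (Suc i) \<le> 2 * real (Suc (i div 2))" by linarith
      then have "\<epsilon> / (2 * real (Suc (i div 2))) \<le> \<epsilon> / real (Suc i)"
        using \<epsilon> by (intro divide_left_mono) auto
      ultimately show "diameter (C i) \<le> \<epsilon> / real (Suc i)" "bounded (C i)" by simp_all
    qed
    have "\<epsilon> / real (Suc i) \<le> \<delta>" for i
    proof -
      have "\<epsilon> / real (Suc i) \<le> \<epsilon> / 1" using \<epsilon> by (intro divide_left_mono) auto
      then show ?thesis using \<epsilon> by simp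
    qed
    then have diam_le: "diameter (C i) \<le> \<delta>" for i using diam(1)[of i] order_trans by blast
    have cover: "x \<in> (\<Union>i. C i)" for x
    proof -
      obtain i where i: "H i \<le> \<bar>x\<bar> / (\<epsilon> / 2)" "\<bar>x\<bar> / (\<epsilon> / 2) \<le> H (Suc i)"
        using H_between[of "\<bar>x\<bar> / (\<epsilon> / 2)"] \<epsilon> by auto
      then have "\<bar>x\<bar> \<in> {\<epsilon> / 2 * H i .. \<epsilon> / 2 * H (Suc i)}"
        using \<epsilon> by (auto simp: field_simps)
      then have "\<bar>x\<bar> \<in> D (2 * i)" "\<bar>x\<bar> \<in> D (2 * i + 1)" by (auto simp: D_def)
      then have "x \<in> C (2 * i) \<or> x \<in> C (2 * i + 1)"
        unfolding C_def by (cases "x \<ge> 0") (auto intro: image_eqI[of _ _ "-x"])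
      then show ?thesis by blast
    qed
    have "hausdorff_pre s \<delta> E \<le> (\<Sum>i. ennreal (diameter (C i) powr s))"
      unfolding hausdorff_pre_def using diam(2) diam_le cover by (intro INF_lower) auto
    also have "\<dots> \<le> (\<Sum>i. ennreal (\<epsilon> powr s * real (Suc i) powr - s))"
    proof (intro suminf_le ennreal_leI)
      fix i
      have "diameter (C i) powr s \<le> (\<epsilon> / real (Suc i)) powr s"
        using s diam diameter_ge_0 by (intro powr_mono2) auto
      also have "\<dots> = \<epsilon> powr s * real (Suc i) powr - s"
        using \<epsilon> by (simp add: powr_divide powr_minus_divide)
      finally show "diameter (C i) powr s \<le> \<epsilon> powr s * real (Suc i) powr - s" .
    qed auto
    also have "\<dots> = ennreal (\<epsilon> powr s * Z)"
      unfolding Z_def suminf_mult[OF summ, symmetric]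
      by (intro suminf_ennreal2 summable_mult summ) simp
    finally show ?thesis .
  qed
  have "hausdorff_pre s \<delta> E = 0" if \<delta>: "\<delta> > 0" for \<delta>
  proof -
    have eps: "hausdorff_pre s \<delta> E \<le> 0 + ennreal e" if e: "e > 0" for e
    proof -
      have "((\<lambda>\<epsilon>::real. \<epsilon> powr s * Z) \<longlongrightarrow> 0 powr s * Z) (at_right 0)"
        using s by (intro tendsto_intros tendsto_powr' tendsto_ident_at)
          (auto simp: eventually_at_right_less intro: eventually_at_right_less[THEN eventually_mono])
      then have "((\<lambda>\<epsilon>::real. \<epsilon> powr s * Z) \<longlongrightarrow> 0) (at_right 0)" by simp
      then have "eventually (\<lambda>\<epsilon>::real. \<epsilon> powr s * Z < e) (at_right 0)"
        using e order_tendstoD(2) by blast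
      moreover have "eventually (\<lambda>\<epsilon>::real. 0 < \<epsilon> \<and> \<epsilon> < \<delta>) (at_right 0)"
        using eventually_at_right_real[OF \<delta>] by simp
      ultimately have "eventually (\<lambda>\<epsilon>. \<epsilon> powr s * Z < e \<and> 0 < \<epsilon> \<and> \<epsilon> < \<delta>) (at_right 0)"
        by eventually_elim auto
      from eventually_happens'[OF trivial_limit_at_right_real this] obtain \<epsilon> where "\<epsilon> powr s * Z < e" "0 < \<epsilon>" "\<epsilon> < \<delta>"
    by blast
      then show ?thesis using small[of \<epsilon> \<delta>] by (simp add: ennreal_leI order_trans)
    qed
    have "hausdorff_pre s \<delta> E \<le> 0" by (rule ennreal_le_epsilon) (rule eps)
    then show ?thesis by simp
  qed
  then show ?thesis unfolding hausdorff_measure_def by (intro antisym SUP_least) auto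
qed

text \<open>The condition \<open>u \<le> v + 1\<close> makes the bound nonnegative, so that it also
  holds when no integer lies between \<open>u\<close> and \<open>v\<close>.\<close>

lemma
  fixes u v :: real
  shows finite_nat_between: "finite {n :: nat. u \<le> real n \<and> real n \<le> v}"
    and card_nat_between: "u \<le> v + 1 \<Longrightarrow> real (card {n :: nat. u \<le> real n \<and> real n \<le> v}) \<le> v - u + 1"
    and finite_int_between: "finite {n :: int. u \<le> real_of_int n \<and> real_of_int n \<le> v}"
    and card_int_between: "u \<le> v + 1 \<Longrightarrow> real (card {n :: int. u \<le> real_of_int n \<and> real_of_int n \<le> v}) \<le> v - u + 1"
proof -
  have eq: "{n :: int. u \<le> real_of_int n \<and> real_of_int n \<le> v} = {\<lceil>u\<rceil>..\<lfloor>v\<rfloor>}"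
    by (auto simp: ceiling_le_iff le_floor_iff)
  show fin: "finite {n :: int. u \<le> real_of_int n \<and> real_of_int n \<le> v}"
    unfolding eq by simp
  have sub: "int ` {n :: nat. u \<le> real n \<and> real n \<le> v} \<subseteq> {n :: int. u \<le> real_of_int n \<and> real_of_int n \<le> v}"
    by auto
  then show "finite {n :: nat. u \<le> real n \<and> real n \<le> v}"
    using finite_imageD[OF finite_subset[OF _ fin] inj_on_of_nat] by simp
  assume uv: "u \<le> v + 1"
  show "real (card {n :: int. u \<le> real_of_int n \<and> real_of_int n \<le> v}) \<le> v - u + 1"
    unfolding eq using uv by simp linarith
  then show "real (card {n :: nat. u \<le> real n \<and> real n \<le> v}) \<le> v - u + 1"
    using card_inj_on_le[OF inj_on_of_nat sub fin] by linarith
qed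

subsection \<open>Cantor sets in which half of the cells survive\<close>

text \<open>Cells are closed, so neighbours share an endpoint. In return finite unions of cells are
  compact; disjointness is argued on the indices instead.\<close>

definition cell :: "nat \<Rightarrow> nat \<Rightarrow> real set" where
  "cell L k = {real k / real L .. real (Suc k) / real L}"

lemma cell_subset:
  assumes "R > 0" "j \<in> {k * R..<Suc k * R}"
  shows "cell (L * R) j \<subseteq> cell L k"
proof (cases "L = 0")
  case False
  have "k * R \<le> j" "Suc j \<le> Suc k * R" using assms by auto
  then have "real k * real R \<le> real j" "real (Suc j) \<le> real (Suc k) * real R"
    by (metis of_nat_le_iff of_nat_mult)+
  then have "real k * real R / (real L * real R) \<le> real j / (real L * real R)"
    "real (Suc j) / (real L * real R) \<le> real (Suc k) * real R / (real L * real R)"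
    by (intro divide_right_mono; simp)+
  then have "real k / real L \<le> real j / real (L * R)" "real (Suc j) / real (L * R) \<le> real (Suc k) / real L"
    using assms(1) by simp_all
  then show ?thesis unfolding cell_def by (simp only: atLeastatMost_subset_iff) blast
qed (simp add: cell_def)

text \<open>Used to replace a covering set of diameter \<open>d\<close> by an open ball of strictly
  larger radius at small cost. As \<open>s > 0\<close>, continuity holds at \<open>d = 0\<close>
  too, which covers one-point sets.\<close>

lemma powr_approx_right:
  fixes d s e \<eta> :: real
  assumes "0 \<le> d" "d < \<eta>" "0 < e" "0 < s"
  shows "\<exists>r>d. r < \<eta> \<and> r powr s \<le> d powr s + e"
proof -
  have "((\<lambda>r. r powr s) \<longlongrightarrow> d powr s) (at_right d)"
    using assms by (intro tendsto_powr' tendsto_ident_at tendsto_const)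
      (auto intro!: eventually_at_right_less[THEN eventually_mono])
  then have "eventually (\<lambda>r. r powr s < d powr s + e) (at_right d)"
    using assms(3) by (intro order_tendstoD) auto
  moreover have "eventually (\<lambda>r. d < r \<and> r < \<eta>) (at_right d)"
    using eventually_at_right_real[OF assms(2)] by simp
  ultimately have "eventually (\<lambda>r. r powr s < d powr s + e \<and> d < r \<and> r < \<eta>) (at_right d)"
    by eventually_elim auto
  from eventually_happens'[OF trivial_limit_at_right_real this] obtain r where "r powr s < d powr s + e" "d < r" "r < \<eta>"
    by blast
  then show ?thesis by (intro exI[of _ r]) auto
qed

text \<open>The tree lives on indices: \<open>k \<in> S t\<close> stands for
  \<open>cell (L t) k\<close>, which splits into \<open>2 * h t\<close> children. Keeping exactly
  half of them, rather than at least half, turns the counts below into identities.\<close>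

locale cantor_tree =
  fixes L h :: "nat \<Rightarrow> nat" and ch :: "nat \<Rightarrow> nat \<Rightarrow> nat set" and S :: "nat \<Rightarrow> nat set"
  assumes L_0: "L 0 > 0" and h_pos: "h t > 0" and L_Suc: "L (Suc t) = L t * (2 * h t)"
    and S_0: "S 0 = {0}" and S_Suc: "S (Suc t) = (\<Union>k\<in>S t. ch t k)"
    and ch_subset: "k \<in> S t \<Longrightarrow> ch t k \<subseteq> {k * (2 * h t)..<Suc k * (2 * h t)}"
    and card_ch: "k \<in> S t \<Longrightarrow> card (ch t k) = h t"
begin

definition limit_set :: "real set" where
  "limit_set = (\<Inter>t. \<Union>k\<in>S t. cell (L t) k)"

primrec desc :: "nat \<Rightarrow> nat set \<Rightarrow> nat \<Rightarrow> nat set" where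
  "desc t K 0 = K"
| "desc t K (Suc m) = (\<Union>k\<in>desc t K m. ch (t + m) k)"

lemma L_pos: "L t > 0"
  by (induction t) (auto simp: L_0 L_Suc h_pos)

lemma L_ge_power: "L t \<ge> 2 ^ t"
proof (induction t)
  case (Suc t)
  then have "2 ^ t * 2 \<le> L t * (2 * h t)" using h_pos[of t] by (intro mult_mono) auto
  then show ?case by (simp add: L_Suc)
qed (use L_0 in simp)

lemma desc_S: "desc t (S t) m = S (t + m)"
  by (induction m) (auto simp: S_Suc)

lemma desc_subset: "K \<subseteq> S t \<Longrightarrow> desc t K m \<subseteq> S (t + m)"
  by (induction m) (auto simp: S_Suc)

text \<open>Dividing an index by \<open>2 * h (t + m)\<close> recovers its parent, so different
  cells have disjoint sets of children. Hence all surviving cells of a level have equally many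
  descendants, and counting can replace a measure on the limit set.\<close>

lemma card_desc:
  assumes "K \<subseteq> S t" "finite K"
  shows "finite (desc t K m) \<and> card (desc t K m) = card K * (\<Prod>i<m. h (t + i))"
proof (induction m)
  case (Suc m)
  have in_S: "k \<in> S (t + m)" if "k \<in> desc t K m" for k
    using desc_subset[OF assms(1)] that by blast
  have fin: "finite (ch (t + m) k)" if "k \<in> desc t K m" for k
    using ch_subset[OF in_S[OF that]] finite_subset by blast
  have disj: "ch (t + m) k \<inter> ch (t + m) l = {}"
    if "k \<in> desc t K m" "l \<in> desc t K m" "k \<noteq> l" for k l
  proof -
    have "j div (2 * h (t + m)) = k" if "j \<in> {k * (2 * h (t + m))..<Suc k * (2 * h (t + m))}" for j k
      using that h_pos[of "t + m"] by (intro div_nat_eqI) (auto simp: mult.commute)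
    then show ?thesis
      using ch_subset[OF in_S[OF that(1)]] ch_subset[OF in_S[OF that(2)]] that(3) by blast
  qed
  have "card (desc t K (Suc m)) = (\<Sum>k\<in>desc t K m. card (ch (t + m) k))"
    using Suc fin disj by (simp add: card_UN_disjoint)
  also have "\<dots> = card (desc t K m) * h (t + m)" using card_ch in_S by simp
  finally show ?case using Suc fin by simp
qed (use assms in simp)

text \<open>\<open>L t\<close> is \<open>L 0\<close> times the product of the
  \<open>2 * h i\<close>, and \<open>card (S t)\<close> is the product of the \<open>h i\<close>.
  The share \<open>1 / card (S t)\<close> of one cell thus exceeds its length only by the factor
  \<open>L 0 * 2 ^ t\<close>.\<close>

lemma finite_S: "finite (S t)" and card_S: "L t = L 0 * 2 ^ t * card (S t)"
proof -
  have *: "finite (S t) \<and> card (S t) = (\<Prod>i<t. h i)"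
    using card_desc[of "S 0" 0 t] desc_S[of 0 t] by (simp add: S_0)
  then show "finite (S t)" by simp
  have "L t = L 0 * 2 ^ t * (\<Prod>i<t. h i)" by (induction t) (auto simp: L_Suc)
  then show "L t = L 0 * 2 ^ t * card (S t)" using * by simp
qed

lemma card_S_pos: "card (S t) > 0"
  using card_S[of t] L_pos[of t] by (auto intro: gr0I)

lemma cell_child: "k \<in> S t \<Longrightarrow> j \<in> ch t k \<Longrightarrow> cell (L (Suc t)) j \<subseteq> cell (L t) k"
  unfolding L_Suc using ch_subset[of k t] h_pos[of t] by (intro cell_subset) (simp, blast)

lemma desc_ancestor:
  assumes "K \<subseteq> S t" "j \<in> desc t K m"
  shows "\<exists>k\<in>K. j \<in> desc t {k} m \<and> cell (L (t + m)) j \<subseteq> cell (L t) k"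
  using assms(2)
proof (induction m arbitrary: j)
  case (Suc m)
  then obtain i where i: "i \<in> desc t K m" "j \<in> ch (t + m) i" by auto
  then obtain k where k: "k \<in> K" "i \<in> desc t {k} m" "cell (L (t + m)) i \<subseteq> cell (L t) k"
    using Suc.IH by blast
  have "cell (L (Suc (t + m))) j \<subseteq> cell (L (t + m)) i"
    using desc_subset[OF assms(1)] i by (intro cell_child) auto
  then show ?case using i k by auto
qed auto

section \<open>Mass distribution by counting surviving cells\<close>

definition hits :: "nat \<Rightarrow> real set \<Rightarrow> nat set" where
  "hits t V = {j \<in> S t. cell (L t) j \<inter> V \<noteq> {}}"

lemma hits_subset_desc: "hits (t + m) V \<subseteq> desc t (hits t V) m"
proof
  fix j assume j: "j \<in> hits (t + m) V"
  then have "j \<in> desc t (S t) m" by (simp add: hits_def desc_S)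
  then obtain k where k: "k \<in> S t" "j \<in> desc t {k} m" "cell (L (t + m)) j \<subseteq> cell (L t) k"
    using desc_ancestor[of "S t"] by blast
  then have "{k} \<subseteq> hits t V" using j by (auto simp: hits_def)
  moreover have "desc t A m \<subseteq> desc t B m" if "A \<subseteq> B" for A B
    using that by (induction m) auto
  ultimately show "j \<in> desc t (hits t V) m" using k(2) by blast
qed

lemma card_hits_interval:
  assumes "u \<le> v"
  shows "real (card (hits t {u..v})) \<le> (v - u) * real (L t) + 2"
proof -
  have "hits t {u..v} \<subseteq> {j. u * real (L t) - 1 \<le> real j \<and> real j \<le> v * real (L t)}"
    using L_pos[of t] by (auto simp: hits_def cell_def field_simps dest: order_trans)
  then have "real (card (hits t {u..v})) \<le> real (card {j. u * real (L t) - 1 \<le> real j \<and> real j \<le> v * real (L t)})"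
    using finite_nat_between by (simp add: card_mono)
  also have "\<dots> \<le> v * real (L t) - (u * real (L t) - 1) + 1"
  proof (rule card_nat_between)
    show "u * real (L t) - 1 \<le> v * real (L t) + 1"
      using mult_right_mono[OF assms, of "real (L t)"] by simp
  qed
  finally show ?thesis by (simp add: algebra_simps)
qed

text \<open>An interval at least as long as a level-\<open>t\<close> cell meets at most three times
  its length times \<open>L t\<close> of them, the two extra boundary cells being absorbed. Each
  carries the share \<open>1 / card (S t)\<close> of the cells at level \<open>T\<close>, and
  \<open>card_S\<close> rewrites \<open>L t / card (S t)\<close>.\<close>

lemma card_hits_deep:
  assumes "u \<le> v" "(v - u) * real (L t) \<ge> 1" "t \<le> T"
  shows "real (card (hits T {u..v})) \<le> 3 * (v - u) * real (L 0) * 2 ^ t * real (card (S T))"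
proof -
  obtain m where m: "T = t + m" using assms(3) le_Suc_ex by blast
  define P where "P = (\<Prod>i<m. h (t + i))"
  have sub: "hits t V \<subseteq> S t" and fin: "finite (hits t V)" for V
    using finite_S[of t] by (auto simp: hits_def)
  have ST: "card (S T) = card (S t) * P"
    using card_desc[of "S t" t m] finite_S by (simp add: desc_S m P_def)
  have "card (hits T {u..v}) \<le> card (desc t (hits t {u..v}) m)"
    unfolding m using card_desc[OF sub fin] hits_subset_desc by (intro card_mono) auto
  also have "\<dots> = card (hits t {u..v}) * P" using card_desc[OF sub fin] by (simp add: P_def)
  finally have "real (card (hits T {u..v})) \<le> real (card (hits t {u..v})) * real P"
    by (metis of_nat_le_iff of_nat_mult)
  also have "\<dots> \<le> (3 * (v - u) * real (L t)) * real P"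
    using card_hits_interval[OF assms(1), of t] assms(2) by (intro mult_right_mono; linarith)
  also have "\<dots> = 3 * (v - u) * real (L 0) * 2 ^ t * real (card (S T))"
    by (subst card_S[of t]) (simp add: ST)
  finally show ?thesis .
qed

text \<open>Compactness is used twice: for a finite subcover of the limit set, and for the
  decreasing compact sets left outside that subcover, whose intersection is empty, so that one of
  them is already empty. Covers of the limit set then become statements about finitely many
  cells.\<close>

lemma limit_set_covering:
  assumes "limit_set \<subseteq> (\<Union>i. V i)" "\<And>i. open (V i)"
  shows "\<exists>F T0. finite (F :: nat set) \<and> (\<forall>T\<ge>T0. (\<Union>k\<in>S T. cell (L T) k) \<subseteq> (\<Union>i\<in>F. V i))"
proof -
  define A where "A t = (\<Union>k\<in>S t. cell (L t) k)" for t
  have comp: "compact (A t)" for t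
    unfolding A_def cell_def using finite_S by (intro compact_UN) auto
  have "A (Suc t) \<subseteq> A t" for t
    using cell_child unfolding A_def S_Suc by blast
  then have anti: "A n \<subseteq> A m" if "m \<le> n" for m n
    using that by (rule lift_Suc_antimono_le)
  have lim: "limit_set = (\<Inter>t. A t)" by (simp add: limit_set_def A_def)
  have "compact limit_set"
    unfolding lim using comp by (intro compact_Inter) auto
  then obtain F where F: "finite F" "limit_set \<subseteq> (\<Union>i\<in>F. V i)"
    using compactE_image[of limit_set UNIV V] assms by metis
  have "\<exists>T0. A T0 - (\<Union>i\<in>F. V i) = {}"
  proof (rule ccontr)
    assume *: "\<nexists>T0. A T0 - (\<Union>i\<in>F. V i) = {}"
    have "(\<Inter>t. A t - (\<Union>i\<in>F. V i)) \<noteq> {}"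
    proof (rule compact_nest)
      show "compact (A t - (\<Union>i\<in>F. V i))" for t
        using comp assms(2) by (intro compact_diff) auto
    qed (use * anti in blast)+
    then show False using F(2) lim by auto
  qed
  then show ?thesis using F(1) anti unfolding A_def by (metis Diff_eq_empty_iff order_trans)
qed

lemma growth_const_pos:
  assumes "\<And>t. 2 ^ t \<le> B * real (L t) powr (1 - s)"
  shows "B > 0"
proof (rule ccontr)
  assume "\<not> B > 0"
  then have "B * real (L 0) powr (1 - s) \<le> 0" by (simp add: mult_nonpos_nonneg)
  then show False using assms[of 0] by simp
qed

lemma sum_lengths_powr_ge:
  fixes x r :: "nat \<Rightarrow> real"
  assumes growth: "\<And>t. 2 ^ t \<le> B * real (L t) powr (1 - s)" and s: "s < 1"
    and cover: "limit_set \<subseteq> (\<Union>i. ball (x i) (r i))"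
    and r: "\<And>i. 0 < r i" "\<And>i. 2 * r i < 1 / real (L 0)"
  shows "\<exists>F. finite F \<and> 1 \<le> 12 * real (L 0) * B * (\<Sum>i\<in>F. r i powr s)"
proof -
  have B: "B > 0"
    by (rule growth_const_pos[OF growth])
  \<comment> \<open>Cells are counted at level \<open>Suc t\<close>, where the interval is longer
    than a cell, but growth is applied at level \<open>t\<close>, where \<open>r i\<close> is below
    the cell length. The mismatch costs only a factor 2, however large
    \<open>L (Suc t) / L t\<close> is.\<close>
  have ex: "\<exists>t. 1 / real (L (Suc t)) \<le> 2 * r i \<and> 2 * r i < 1 / real (L t)" for i
  proof -
    obtain n where n: "1 / (2 * r i) < 2 ^ n" using real_arch_pow[of 2 "1 / (2 * r i)"] by auto
    have "real (2 ^ n) \<le> real (L n)" using L_ge_power of_nat_le_iff by blast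
    then have "1 / (2 * r i) < real (L n)" using n unfolding of_nat_power of_nat_numeral by linarith
    then have ex: "\<exists>n. 1 / real (L n) \<le> 2 * r i"
      using r(1)[of i] L_pos[of n] by (intro exI[of _ n]) (auto simp: field_simps)
    define n0 where "n0 = (LEAST n. 1 / real (L n) \<le> 2 * r i)"
    have n0: "1 / real (L n0) \<le> 2 * r i" unfolding n0_def using ex by (rule LeastI_ex)
    have "n0 \<noteq> 0" using n0 r(2)[of i] by (auto intro: ccontr)
    then obtain t where t: "n0 = Suc t" using not0_implies_Suc by blast
    then have "\<not> 1 / real (L t) \<le> 2 * r i"
      using not_less_Least[of t "\<lambda>n. 1 / real (L n) \<le> 2 * r i"] n0_def by simp
    then show ?thesis using n0 t by auto
  qed
  then obtain \<tau> where \<tau>: "\<And>i. 1 / real (L (Suc (\<tau> i))) \<le> 2 * r i" "\<And>i. 2 * r i < 1 / real (L (\<tau> i))"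
    by metis
  obtain F T0 where F: "finite F" and
    T0: "\<And>T. T \<ge> T0 \<Longrightarrow> (\<Union>k\<in>S T. cell (L T) k) \<subseteq> (\<Union>i\<in>F. ball (x i) (r i))"
    using limit_set_covering[OF cover] by auto
  define T where "T = Max (insert T0 ((\<lambda>i. Suc (\<tau> i)) ` F))"
  have T: "T0 \<le> T" "\<And>i. i \<in> F \<Longrightarrow> Suc (\<tau> i) \<le> T" unfolding T_def using F by auto
  let ?V = "\<lambda>i. {x i - r i..x i + r i}"
  have "S T \<subseteq> (\<Union>i\<in>F. hits T (?V i))"
  proof
    fix k assume k: "k \<in> S T"
    have "real k / real (L T) \<in> cell (L T) k" by (simp add: cell_def divide_right_mono)
    moreover from this obtain i where i: "i \<in> F" "real k / real (L T) \<in> ball (x i) (r i)"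
      using T0[OF T(1)] k by blast
    then have "real k / real (L T) \<in> ?V i" by (auto simp: dist_real_def)
    ultimately show "k \<in> (\<Union>i\<in>F. hits T (?V i))" using k i(1) unfolding hits_def by blast
  qed
  then have "card (S T) \<le> card (\<Union>i\<in>F. hits T (?V i))"
    using F finite_S by (intro card_mono) (auto simp: hits_def)
  also have "\<dots> \<le> (\<Sum>i\<in>F. card (hits T (?V i)))" using F by (rule card_UN_le)
  finally have "real (card (S T)) \<le> (\<Sum>i\<in>F. real (card (hits T (?V i))))"
    by (metis of_nat_le_iff of_nat_sum)
  also have "\<dots> \<le> (\<Sum>i\<in>F. 12 * real (L 0) * B * r i powr s * real (card (S T)))"
  proof (rule sum_mono)
    fix i assume i: "i \<in> F"
    have L: "real (L (\<tau> i)) > 0" "real (L (Suc (\<tau> i))) > 0" using L_pos by auto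
    have len: "x i + r i - (x i - r i) = 2 * r i" by simp
    have "1 \<le> 2 * r i * real (L (Suc (\<tau> i)))" using \<tau>(1)[of i] L by (simp add: field_simps)
    then have "real (card (hits T (?V i))) \<le> 3 * (2 * r i) * real (L 0) * 2 ^ Suc (\<tau> i) * real (card (S T))"
      using card_hits_deep[of "x i - r i" "x i + r i" "Suc (\<tau> i)" T] T(2)[OF i] r(1)[of i]
      unfolding len by simp
    also have "\<dots> = 12 * real (L 0) * (r i * 2 ^ \<tau> i) * real (card (S T))" by simp
    \<comment> \<open>Since \<open>L (\<tau> i) \<le> 1 / r i\<close>, the growth hypothesis bounds
      \<open>2 ^ \<tau> i\<close> by \<open>B * r i powr (s - 1)\<close>.\<close>
    also have "\<dots> \<le> 12 * real (L 0) * (B * r i powr s) * real (card (S T))"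
    proof (intro mult_left_mono mult_right_mono)
      have "r i \<le> 1 / real (L (\<tau> i))" using \<tau>(2)[of i] r(1)[of i] by linarith
      then have "real (L (\<tau> i)) \<le> 1 / r i" using L r(1)[of i] by (simp add: field_simps)
      then have "real (L (\<tau> i)) powr (1 - s) \<le> (1 / r i) powr (1 - s)"
        using s by (intro powr_mono2) auto
      then have "2 ^ \<tau> i \<le> B * (1 / r i) powr (1 - s)"
        using growth[of "\<tau> i"] B by (meson mult_left_mono less_imp_le order_trans)
      then have "r i * 2 ^ \<tau> i \<le> r i * (B * (1 / r i) powr (1 - s))"
        using r(1)[of i] by simp
      also have "\<dots> = B * r i powr s"
        using r(1)[of i] by (simp add: powr_divide powr_diff)
      finally show "r i * 2 ^ \<tau> i \<le> B * r i powr s" .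
    qed auto
    finally show "real (card (hits T (?V i))) \<le> 12 * real (L 0) * B * r i powr s * real (card (S T))"
      by (simp add: mult.assoc)
  qed
  also have "\<dots> = (12 * real (L 0) * B * (\<Sum>i\<in>F. r i powr s)) * real (card (S T))"
    by (simp add: sum_distrib_left sum_distrib_right)
  finally have "1 \<le> 12 * real (L 0) * B * (\<Sum>i\<in>F. r i powr s)"
    using card_S_pos[of T] by simp
  then show ?thesis using F by blast
qed

lemma hausdorff_measure_limit_set:
  assumes growth: "\<And>t. 2 ^ t \<le> B * real (L t) powr (1 - s)" and s: "0 < s" "s < 1"
  shows "hausdorff_measure s limit_set \<noteq> 0"
proof -
  have B: "B > 0"
    by (rule growth_const_pos[OF growth])
  \<comment> \<open>Half of the lower bound that \<open>sum_lengths_powr_ge\<close> gives for covers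
    by balls; the other half pays for enlarging the covering sets to balls.\<close>
  define \<kappa> where "\<kappa> = 1 / (24 * real (L 0) * B)"
  have \<kappa>: "\<kappa> > 0" using B L_0 by (simp add: \<kappa>_def)
  \<comment> \<open>Half of the admissible radius \<open>1 / (2 * L 0)\<close>, leaving room for
    strictly larger radii.\<close>
  define \<delta> where "\<delta> = 1 / (4 * real (L 0))"
  have \<delta>: "\<delta> > 0" using L_0 by (simp add: \<delta>_def)
  have "ennreal \<kappa> \<le> hausdorff_pre s \<delta> limit_set"
    unfolding hausdorff_pre_def
  proof (rule INF_greatest, rule ccontr)
    fix C :: "nat \<Rightarrow> real set"
    assume "C \<in> {C. (\<forall>i. bounded (C i) \<and> diameter (C i) \<le> \<delta>) \<and> limit_set \<subseteq> \<Union> (range C)}"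
    then have C: "\<And>i. bounded (C i)" "\<And>i. diameter (C i) \<le> \<delta>" "limit_set \<subseteq> (\<Union>i. C i)" by auto
    assume "\<not> ennreal \<kappa> \<le> (\<Sum>i. ennreal (diameter (C i) powr s))"
    then have small: "(\<Sum>i. ennreal (diameter (C i) powr s)) < ennreal \<kappa>" by simp
    have d0: "0 \<le> diameter (C i)" for i using C(1) by (rule diameter_ge_0)
    have dlt: "diameter (C i) < 1 / (2 * real (L 0))" for i
    proof -
      have "\<delta> < 1 / (2 * real (L 0))" using L_0 by (simp add: \<delta>_def field_simps)
      then show ?thesis using C(2)[of i] by simp
    qed
    \<comment> \<open>The strict inequality lets an open ball around any point of \<open>C i\<close>
      contain \<open>C i\<close>. The extra costs form a geometric series with sum
      \<open>\<kappa>\<close>.\<close>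
    have "\<exists>r>diameter (C i). r < 1 / (2 * real (L 0)) \<and> r powr s \<le> diameter (C i) powr s + \<kappa> * (1/2) ^ Suc i" for i
      using \<kappa> d0 dlt s by (intro powr_approx_right) auto
    then obtain r where r: "\<And>i. r i > diameter (C i)" "\<And>i. r i < 1 / (2 * real (L 0))"
      "\<And>i. r i powr s \<le> diameter (C i) powr s + \<kappa> * (1/2) ^ Suc i" by metis
    have "\<exists>x. C i \<subseteq> ball x (r i)" for i
    proof (cases "C i = {}")
      case False
      then obtain x where x: "x \<in> C i" by blast
      have "C i \<subseteq> ball x (r i)"
        using diameter_bounded_bound[OF C(1) x] r(1)[of i] by (force simp: dist_real_def)
      then show ?thesis by blast
    qed auto
    then obtain x where x: "\<And>i. C i \<subseteq> ball (x i) (r i)" by metis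
    have cov: "limit_set \<subseteq> (\<Union>i. ball (x i) (r i))" using C(3) UN_mono[of UNIV UNIV C, OF _ x] by simp
    have r2: "2 * r i < 1 / real (L 0)" for i using r(2)[of i] L_0 by (simp add: field_simps)
    have r1: "0 < r i" for i using r(1)[of i] d0[of i] by linarith
    obtain F where F: "finite F" "1 \<le> 12 * real (L 0) * B * (\<Sum>i\<in>F. r i powr s)"
      using sum_lengths_powr_ge[OF growth s(2) cov r1 r2] by blast
    have "ennreal (\<Sum>i\<in>F. diameter (C i) powr s) = (\<Sum>i\<in>F. ennreal (diameter (C i) powr s))"
      by simp
    also have "\<dots> \<le> (\<Sum>i. ennreal (diameter (C i) powr s))"
      using F(1) by (intro sum_le_suminf) auto
    also note small
    finally have lt: "(\<Sum>i\<in>F. diameter (C i) powr s) < \<kappa>"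
      by (simp add: ennreal_less_iff sum_nonneg)
    have "(\<Sum>i\<in>F. (1/2::real) ^ Suc i) \<le> (\<Sum>i. (1/2) ^ Suc i)"
      using F(1) power_half_series sums_summable by (intro sum_le_suminf) auto
    then have "(\<Sum>i\<in>F. (1/2::real) ^ Suc i) \<le> 1" using power_half_series sums_unique by metis
    then have "\<kappa> * (\<Sum>i\<in>F. (1/2::real) ^ Suc i) \<le> \<kappa>" using \<kappa> by (simp add: mult_left_le)
    moreover have "(\<Sum>i\<in>F. r i powr s) \<le> (\<Sum>i\<in>F. diameter (C i) powr s + \<kappa> * (1/2) ^ Suc i)"
      using r(3) by (intro sum_mono)
    ultimately have "(\<Sum>i\<in>F. r i powr s) < 2 * \<kappa>"
      using lt by (simp add: sum.distrib sum_distrib_left)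
    moreover have "12 * real (L 0) * B > 0" using B L_0 by simp
    ultimately have "12 * real (L 0) * B * (\<Sum>i\<in>F. r i powr s) < 12 * real (L 0) * B * (2 * \<kappa>)"
      by (intro mult_strict_left_mono)
    also have "\<dots> = 1" using B L_0 by (simp add: \<kappa>_def)
    finally show False using F(2) by simp
  qed
  moreover have "hausdorff_pre s \<delta> limit_set \<le> hausdorff_measure s limit_set"
    unfolding hausdorff_measure_def using \<delta> by (intro SUP_upper) auto
  ultimately have "ennreal \<kappa> \<le> hausdorff_measure s limit_set" by (rule order_trans)
  then show ?thesis using \<kappa> by auto
qed

end

text \<open>
  A cell is kept only if at most a quarter of its children are forbidden one step later. This
  look-ahead is what makes the hypothesis usable: it bounds the forbidden cells only inside
  grandparents, not inside parents. By Markov's inequality at most a quarter of the children of any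
  cell fail the look-ahead, and at most a quarter of those of a kept cell are forbidden.
\<close>

lemma cantor_tree_avoiding:
  fixes L h :: "nat \<Rightarrow> nat" and X :: "nat \<Rightarrow> nat set"
  assumes L_0: "L 0 > 0" and h_pos: "\<And>t. h t > 0" and L_Suc: "\<And>t. L (Suc t) = L t * (2 * h t)"
    and X_0: "X 0 = {}"
    and X_sparse: "\<And>t k. 4 * card (X (Suc t) \<inter> {k * (2 * h t * (2 * h (Suc t)))..<Suc k * (2 * h t * (2 * h (Suc t)))})
                     \<le> h t * h (Suc t)"
  shows "\<exists>ch S. cantor_tree L h ch S \<and> (\<forall>t. S (Suc t) \<inter> X t = {})"
proof -
  \<comment> \<open>Mind the shift: \<open>X t\<close> consists of indices of level
    \<open>Suc t\<close>, so \<open>X t \<inter> I t k\<close> collects the forbidden children of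
    cell \<open>k\<close> of level \<open>t\<close>.\<close>
  define I where "I t k = {k * (2 * h t)..<Suc k * (2 * h t)}" for t k
  define good where "good t k \<longleftrightarrow> 2 * card (X t \<inter> I t k) \<le> h t" for t k
  have "\<exists>C. C \<subseteq> {j \<in> I t k. j \<notin> X t \<and> good (Suc t) j} \<and> card C = h t" if g: "good t k" for t k
  proof -
    define Bd where "Bd = {j \<in> I t k. \<not> good (Suc t) j}"
    have fin: "finite (I t k)" for t k by (simp add: I_def)
    have finB: "finite Bd" using fin by (simp add: Bd_def)
    have sub: "(\<Union>j\<in>Bd. X (Suc t) \<inter> I (Suc t) j) \<subseteq>
        X (Suc t) \<inter> {k * (2 * h t * (2 * h (Suc t)))..<Suc k * (2 * h t * (2 * h (Suc t)))}"
    proof -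
      have "I (Suc t) j \<subseteq> {k * (2 * h t * (2 * h (Suc t)))..<Suc k * (2 * h t * (2 * h (Suc t)))}"
        if "j \<in> I t k" for j
      proof -
        have "k * (2 * h t) * (2 * h (Suc t)) \<le> j * (2 * h (Suc t))"
          "Suc j * (2 * h (Suc t)) \<le> Suc k * (2 * h t) * (2 * h (Suc t))"
          using that unfolding I_def by (intro mult_right_mono; force)+
        then show ?thesis unfolding I_def by (simp only: mult.assoc ivl_subset) auto
      qed
      then show ?thesis unfolding Bd_def by blast
    qed
    have disj: "I (Suc t) i \<inter> I (Suc t) j = {}" if "i \<noteq> j" for i j
    proof -
      have "n div (2 * h (Suc t)) = j" if "n \<in> I (Suc t) j" for n j
        using that h_pos[of "Suc t"] unfolding I_def by (intro div_nat_eqI) (auto simp: mult.commute)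
      then show ?thesis using that by blast
    qed
    \<comment> \<open>Each \<open>j \<in> Bd\<close> has more than \<open>h (Suc t) / 2\<close>
      forbidden children, in disjoint blocks, while \<open>X_sparse\<close> allows only
      \<open>h t * h (Suc t) / 4\<close> of them in total.\<close>
    have "card Bd * h (Suc t) \<le> (\<Sum>j\<in>Bd. 2 * card (X (Suc t) \<inter> I (Suc t) j))"
      using sum_mono[of Bd "\<lambda>_. h (Suc t)" "\<lambda>j. 2 * card (X (Suc t) \<inter> I (Suc t) j)"]
      by (auto simp: Bd_def good_def)
    also have "\<dots> = 2 * card (\<Union>j\<in>Bd. X (Suc t) \<inter> I (Suc t) j)"
      using finB fin disj by (subst card_UN_disjoint) (simp_all add: sum_distrib_left, blast)
    also have "\<dots> \<le> 2 * card (X (Suc t) \<inter> {k * (2 * h t * (2 * h (Suc t)))..<Suc k * (2 * h t * (2 * h (Suc t)))})"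
      using card_mono[OF _ sub] by simp
    finally have "2 * card Bd * h (Suc t) \<le> h t * h (Suc t)" using X_sparse[of t k] by linarith
    then have cB: "2 * card Bd \<le> h t" using h_pos[of "Suc t"] by simp
    have "{j \<in> I t k. j \<notin> X t \<and> good (Suc t) j} = I t k - (X t \<inter> I t k \<union> Bd)"
      by (auto simp: Bd_def)
    moreover have "card (I t k - (X t \<inter> I t k \<union> Bd)) \<ge> card (I t k) - card (X t \<inter> I t k \<union> Bd)"
      using fin finB by (intro diff_card_le_card_Diff) auto
    moreover have "card (X t \<inter> I t k \<union> Bd) \<le> card (X t \<inter> I t k) + card Bd" by (rule card_Un_le)
    moreover have "card (I t k) = 2 * h t" by (simp add: I_def)
    moreover have "2 * card (X t \<inter> I t k) \<le> h t" using g by (simp add: good_def)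
    \<comment> \<open>Of \<open>2 * h t\<close> children, at most \<open>h t / 2\<close> are
      forbidden and at most \<open>h t / 2\<close> fail the look-ahead.\<close>
    ultimately have "h t \<le> card {j \<in> I t k. j \<notin> X t \<and> good (Suc t) j}"
      using cB by simp
    then show ?thesis by (meson obtain_subset_with_card_n)
  qed
  then obtain ch where ch: "\<And>t k. good t k \<Longrightarrow> ch t k \<subseteq> {j \<in> I t k. j \<notin> X t \<and> good (Suc t) j}"
    "\<And>t k. good t k \<Longrightarrow> card (ch t k) = h t" by metis
  define S where "S = rec_nat {0} (\<lambda>t A. \<Union>k\<in>A. ch t k)"
  have S: "S 0 = {0}" "S (Suc t) = (\<Union>k\<in>S t. ch t k)" for t by (auto simp: S_def)
  have good: "good t k" if "k \<in> S t" for t k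
    using that
  proof (induction t arbitrary: k)
    case 0
    then show ?case by (simp add: good_def X_0)
  next
    case (Suc t)
    then show ?case using ch(1) unfolding S by blast
  qed
  have "cantor_tree L h ch S"
  proof
    show "ch t k \<subseteq> {k * (2 * h t)..<Suc k * (2 * h t)}" "card (ch t k) = h t" if "k \<in> S t" for t k
      using ch[OF good[OF that]] unfolding I_def by blast+
  qed (fact L_0 h_pos L_Suc S)+
  moreover have "S (Suc t) \<inter> X t = {}" for t
    using ch(1) good unfolding S by blast
  ultimately show ?thesis by blast
qed

subsection \<open>Cells close to fractions\<close>

text \<open>At most \<open>q / L + 3\<close> fractions with denominator \<open>q\<close> matter for
  a cell of length \<open>1 / L\<close>, and \<open>q \<ge> L\<close> makes this at most
  \<open>4 * q / L\<close>. Each neighbourhood meets at most \<open>2 * \<rho> * L * M + 2\<close>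
  subcells, at most \<open>4 * \<rho> * L * M\<close> because \<open>\<rho>\<close> is no smaller
  than a subcell.\<close>

lemma card_cells_near_fractions:
  fixes L M q k :: nat and \<rho> :: real
  assumes pos: "0 < L" "0 < M" and q: "L \<le> q" and \<rho>: "1 \<le> \<rho> * real (L * M)" "real q * \<rho> \<le> 1"
  shows "real (card {j \<in> {k * M..<Suc k * M}. \<exists>b::int. \<exists>x\<in>cell (L * M) j. \<bar>x - real_of_int b / real q\<bar> < \<rho>})
           \<le> 16 * (real q * \<rho>) * real M"
proof -
  \<comment> \<open>The slack 1 on both sides suffices because
    \<open>real q * \<rho> \<le> 1\<close>.\<close>
  define Bs where "Bs = {b::int. real q * (real k / real L) - 1 \<le> real_of_int b \<and>
    real_of_int b \<le> real q * (real (Suc k) / real L) + 1}"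
  define J where "J b = {j::nat. (real_of_int b / real q - \<rho>) * real (L * M) - 1 \<le> real j \<and>
    real j \<le> (real_of_int b / real q + \<rho>) * real (L * M)}" for b :: int
  have q0: "real q > 0" using pos q by simp
  have LM: "real (L * M) > 0" using pos by simp
  have \<rho>0: "\<rho> > 0"
  proof (rule ccontr)
    assume "\<not> \<rho> > 0"
    then have "\<rho> * real (L * M) \<le> 0" using LM by (simp add: mult_nonpos_nonneg)
    then show False using \<rho>(1) by simp
  qed
  have sub: "{j \<in> {k * M..<Suc k * M}. \<exists>b::int. \<exists>x\<in>cell (L * M) j. \<bar>x - real_of_int b / real q\<bar> < \<rho>}
      \<subseteq> (\<Union>b\<in>Bs. J b)"
  proof
    fix j assume "j \<in> {j \<in> {k * M..<Suc k * M}. \<exists>b::int. \<exists>x\<in>cell (L * M) j. \<bar>x - real_of_int b / real q\<bar> < \<rho>}"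
    then obtain b :: int and x where j: "j \<in> {k * M..<Suc k * M}" and x: "x \<in> cell (L * M) j"
      and b: "\<bar>x - real_of_int b / real q\<bar> < \<rho>" by blast
    have xk: "x \<in> cell L k" using cell_subset[OF pos(2) j] x by blast
    have "\<bar>real q * x - real_of_int b\<bar> = real q * \<bar>x - real_of_int b / real q\<bar>"
      using q0 by (simp add: abs_mult_pos' right_diff_distrib)
    also have "\<dots> \<le> real q * \<rho>" using b q0 by simp
    finally have d: "\<bar>real q * x - real_of_int b\<bar> \<le> 1" using \<rho>(2) by simp
    have "real q * (real k / real L) \<le> real q * x" "real q * x \<le> real q * (real (Suc k) / real L)"
      using xk q0 unfolding cell_def by (intro mult_left_mono; simp)+
    then have "b \<in> Bs" using d unfolding Bs_def by simp linarith
    moreover have "real j \<le> x * real (L * M)" "x * real (L * M) \<le> real j + 1"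
      using x LM unfolding cell_def by (simp_all add: field_simps del: of_nat_mult)
    moreover have "(real_of_int b / real q - \<rho>) * real (L * M) \<le> x * real (L * M)"
      "x * real (L * M) \<le> (real_of_int b / real q + \<rho>) * real (L * M)"
      using b by (intro mult_right_mono; simp)+
    ultimately have "b \<in> Bs" "j \<in> J b" unfolding J_def by (simp_all del: of_nat_mult)
    then show "j \<in> (\<Union>b\<in>Bs. J b)" by blast
  qed
  have finB: "finite Bs" unfolding Bs_def by (rule finite_int_between)
  have finJ: "finite (J b)" for b unfolding J_def by (rule finite_nat_between)
  have "real (card Bs) \<le> real q * (real (Suc k) / real L) + 1 - (real q * (real k / real L) - 1) + 1"
    unfolding Bs_def
  proof (rule card_int_between)
    have "real q * (real k / real L) \<le> real q * (real (Suc k) / real L)"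
      by (intro mult_left_mono divide_right_mono) auto
    then show "real q * (real k / real L) - 1 \<le> real q * (real (Suc k) / real L) + 1 + 1" by simp
  qed
  also have "\<dots> = real q / real L + 3" using pos by (simp add: field_simps)
  also have "\<dots> \<le> 4 * (real q / real L)" using q pos by (simp add: field_simps)
  finally have cB: "real (card Bs) \<le> 4 * (real q / real L)" .
  have cJ: "real (card (J b)) \<le> 4 * (\<rho> * real (L * M))" for b
  proof -
    have "real (card (J b)) \<le> (real_of_int b / real q + \<rho>) * real (L * M)
        - ((real_of_int b / real q - \<rho>) * real (L * M) - 1) + 1"
      unfolding J_def
    proof (rule card_nat_between)
      have "(real_of_int b / real q - \<rho>) * real (L * M) \<le> (real_of_int b / real q + \<rho>) * real (L * M)"
        using \<rho>0 by (intro mult_right_mono) auto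
      then show "(real_of_int b / real q - \<rho>) * real (L * M) - 1
        \<le> (real_of_int b / real q + \<rho>) * real (L * M) + 1" by simp
    qed
    also have "\<dots> = 2 * (\<rho> * real (L * M)) + 2" by (simp add: algebra_simps)
    also have "\<dots> \<le> 4 * (\<rho> * real (L * M))" using \<rho>(1) by simp
    finally show ?thesis .
  qed
  have "card {j \<in> {k * M..<Suc k * M}. \<exists>b::int. \<exists>x\<in>cell (L * M) j. \<bar>x - real_of_int b / real q\<bar> < \<rho>}
      \<le> card (\<Union>b\<in>Bs. J b)" using sub finB finJ by (intro card_mono) auto
  also have "\<dots> \<le> (\<Sum>b\<in>Bs. card (J b))" using finB by (rule card_UN_le)
  finally have "real (card {j \<in> {k * M..<Suc k * M}. \<exists>b::int. \<exists>x\<in>cell (L * M) j. \<bar>x - real_of_int b / real q\<bar> < \<rho>})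
      \<le> (\<Sum>b\<in>Bs. real (card (J b)))" by (simp only: of_nat_le_iff flip: of_nat_sum)
  also have "\<dots> \<le> real (card Bs) * (4 * (\<rho> * real (L * M)))"
    using sum_mono[of Bs "\<lambda>b. real (card (J b))" "\<lambda>_. 4 * (\<rho> * real (L * M))"] cJ by simp
  also have "\<dots> \<le> 4 * (real q / real L) * (4 * (\<rho> * real (L * M)))"
    using cB \<rho>0 by (intro mult_right_mono) auto
  also have "\<dots> = 16 * (real q * \<rho>) * real M" using pos by simp
  finally show ?thesis .
qed

subsection \<open>The weights attached to the denominators\<close>

definition weight :: "real \<Rightarrow> nat \<Rightarrow> nat \<Rightarrow> real" where
  "weight a p q = real q * ln (real q) powr (2 - a) * padic_abs p (int q)
     * ln (2 / padic_abs p (int q)) powr a"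

lemma weight_eq:
  fixes p q :: nat
  assumes "prime p" "q > 0"
  defines "k \<equiv> multiplicity (int p) (int q)"
  shows "weight a p q = real q * ln (real q) powr (2 - a) / real p ^ k * (ln 2 + real k * ln (real p)) powr a"
proof -
  have p: "real p > 0" using assms(1) by (simp add: prime_gt_0_nat)
  have "padic_abs p (int q) = 1 / real p ^ k"
    using assms p by (simp add: padic_abs_def powr_minus powr_realpow divide_simps)
  moreover have "ln (2 * real p ^ k) = ln 2 + real k * ln (real p)"
    using p by (simp add: ln_mult ln_realpow)
  ultimately show ?thesis unfolding weight_def using p by simp
qed

lemma power_multiplicity_dvd_nat: "p ^ multiplicity (int p) (int q) dvd q"
  using multiplicity_dvd[of "int p" "int q"] by (simp flip: of_nat_power)

lemma weight_pos:
  assumes "prime p" "q \<ge> 3"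
  shows "weight a p q > 0"
proof -
  have "p \<ge> 2" using assms prime_ge_2_nat by blast
  moreover have "ln (real p) \<ge> 0" using \<open>p \<ge> 2\<close> by simp
  moreover have "ln (real q) > 0" using assms by simp
  moreover have "ln (2::real) > 0" by simp
  ultimately have "ln 2 + real (multiplicity (int p) (int q)) * ln (real p) > 0"
    by (intro add_pos_nonneg) auto
  then show ?thesis using assms \<open>p \<ge> 2\<close> by (subst weight_eq) auto
qed

text \<open>As \<open>p ^ k \<le> q\<close>, the \<open>p\<close>-adic logarithm is at most
  \<open>2 * ln q\<close>. This crude bound keeps the forbidden intervals from being shorter than
  the cells used to detect them.\<close>

lemma weight_le:
  assumes "prime p" "q \<ge> 3" "0 \<le> a" "a \<le> 1"
  shows "weight a p q \<le> 2 * real q * (ln (real q))\<^sup>2"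
proof -
  define k where "k = multiplicity (int p) (int q)"
  have p: "p \<ge> 2" using assms prime_ge_2_nat by blast
  have lnq: "ln (real q) > 0" "ln 2 \<le> ln (real q)" and q0: "q > 0" using assms by auto
  have "p ^ k \<le> q" using power_multiplicity_dvd_nat assms(2) by (intro dvd_imp_le) (auto simp: k_def)
  then have "real p ^ k \<le> real q" by (metis of_nat_le_iff of_nat_power)
  then have "ln (real p ^ k) \<le> ln (real q)" using p assms(2) by (subst ln_le_cancel_iff) auto
  then have "real k * ln (real p) \<le> ln (real q)" using p by (simp add: ln_realpow)
  then have "ln 2 + real k * ln (real p) \<le> 2 * ln (real q)" using lnq by simp
  moreover have "0 \<le> ln 2 + real k * ln (real p)" using p by (intro add_nonneg_nonneg) auto
  ultimately have "(ln 2 + real k * ln (real p)) powr a \<le> (2 * ln (real q)) powr a"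
    using assms by (intro powr_mono2) auto
  also have "\<dots> = 2 powr a * ln (real q) powr a" using lnq by (simp add: powr_mult)
  also have "\<dots> \<le> 2 * ln (real q) powr a"
    using powr_mono[of a 1 2] assms by (intro mult_right_mono) auto
  finally have 1: "(ln 2 + real k * ln (real p)) powr a \<le> 2 * ln (real q) powr a" .
  have "real p ^ k \<ge> 1" using p by simp
  then have "real q * ln (real q) powr (2 - a) / real p ^ k \<le> real q * ln (real q) powr (2 - a) / 1"
    using p by (intro divide_left_mono) auto
  then have "weight a p q \<le> real q * ln (real q) powr (2 - a) * (2 * ln (real q) powr a)"
    unfolding weight_eq[OF assms(1) q0] k_def[symmetric] using 1 by (intro mult_mono) simp_all
  also have "\<dots> = 2 * real q * (ln (real q) powr (2 - a) * ln (real q) powr a)" by simp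
  also have "ln (real q) powr (2 - a) * ln (real q) powr a = (ln (real q))\<^sup>2"
    using lnq by (simp flip: powr_add)
  finally show ?thesis .
qed

text \<open>Comparison with the integral of \<open>x powr -a\<close>, as a telescoping sum: the mean
  value theorem bounds each term by an increment of \<open>x powr (1 - a) / (1 - a)\<close>. The
  case \<open>n = 0\<close> is separate because differentiability at 0 may fail.\<close>

lemma sum_powr_minus_le:
  fixes a :: real
  assumes "0 \<le> a" "a < 1"
  shows "(\<Sum>k<n. real (Suc k) powr - a) \<le> real n powr (1 - a) / (1 - a)"
proof (induction n)
  case (Suc n)
  have "(1 - a) * real (Suc n) powr - a \<le> real (Suc n) powr (1 - a) - real n powr (1 - a)"
  proof (cases "n = 0")
    case False
    have "\<exists>z. real n < z \<and> z < real (Suc n) \<and> real (Suc n) powr (1 - a) - real n powr (1 - a)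
        = (real (Suc n) - real n) * ((1 - a) * z powr (1 - a - 1))"
      using False by (intro MVT2 has_real_derivative_powr) auto
    then obtain z where z: "real n < z" "z < real (Suc n)"
      "real (Suc n) powr (1 - a) - real n powr (1 - a) = (1 - a) * z powr - a" by auto
    have "real (Suc n) powr - a \<le> z powr - a"
      using z assms False by (intro powr_mono2') auto
    then show ?thesis unfolding z(3) using assms by (intro mult_left_mono) auto
  qed (use assms in simp)
  then have "real (Suc n) powr - a \<le> (real (Suc n) powr (1 - a) - real n powr (1 - a)) / (1 - a)"
    using assms by (simp add: field_simps)
  then show ?case using Suc by (simp add: diff_divide_distrib)
qed simp

lemma sum_inverse_le_ln:
  assumes "n > 0"
  shows "(\<Sum>m = 1..n. 1 / real m) \<le> 1 + ln (real n)"
proof -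
  obtain i where i: "n = Suc i" using assms gr0_implies_Suc by blast
  have "harm (Suc i) - ln (real (Suc i)) \<le> harm (Suc 0) - ln (real (Suc 0))"
    using decseq_harm_diff_ln by (rule decseqD) simp
  then show ?thesis using i by (simp add: harm_def inverse_eq_divide)
qed

text \<open>
  Writing \<open>q = p ^ k * m\<close>, the block sum factors into \<open>\<Sum>1 / m\<close>, of order \<open>ln L\<close>, and
  \<open>\<Sum>(k + 1) powr - a\<close>, of order \<open>(ln L) powr (1 - a)\<close>. Together they cancel \<open>(ln L) powr (a - 2)\<close>.
\<close>

lemma inverse_weight_le:
  assumes "prime p" "3 \<le> L" "L \<le> q" "0 \<le> a" "a < 1"
  defines "k \<equiv> multiplicity (int p) (int q)"
  shows "1 / weight a p q \<le> ln (real L) powr (a - 2) * ln 2 powr - a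
           * (real (Suc k) powr - a * (1 / real (q div p ^ k)))"
proof -
  have p: "p \<ge> 2" using assms prime_ge_2_nat by blast
  have lnL: "ln (real L) > 0" "ln (real L) \<le> ln (real q)" using assms by auto
  have dvd: "p ^ k dvd q" unfolding k_def by (rule power_multiplicity_dvd_nat)
  have qk: "real (q div p ^ k) = real q / real p ^ k" using dvd by (simp add: real_of_nat_div)
  have "ln 2 \<le> ln (real p)" using p by simp
  then have "real k * ln 2 \<le> real k * ln (real p)" by (intro mult_left_mono) auto
  \<comment> \<open>Using \<open>ln p \<ge> ln 2\<close> makes the later bound independent of
    \<open>p\<close>.\<close>
  then have "ln 2 * real (Suc k) \<le> ln 2 + real k * ln (real p)" by (simp add: algebra_simps)
  then have 1: "(ln 2 * real (Suc k)) powr a \<le> (ln 2 + real k * ln (real p)) powr a"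
    using assms by (intro powr_mono2) auto
  have 2: "ln (real L) powr (2 - a) \<le> ln (real q) powr (2 - a)"
    using lnL assms by (intro powr_mono2) auto
  have q0: "real q / real p ^ k > 0" using assms p by simp
  have "real q / real p ^ k * ln (real L) powr (2 - a) * (ln 2 * real (Suc k)) powr a
      \<le> real q / real p ^ k * ln (real q) powr (2 - a) * (ln 2 + real k * ln (real p)) powr a"
    using 1 2 q0 by (intro mult_mono) auto
  also have "\<dots> = weight a p q" using assms by (subst weight_eq) auto
  finally have "real q / real p ^ k * ln (real L) powr (2 - a) * (ln 2 * real (Suc k)) powr a \<le> weight a p q" .
  moreover have "0 < real q / real p ^ k * ln (real L) powr (2 - a) * (ln 2 * real (Suc k)) powr a"
    using q0 lnL by (intro mult_pos_pos) auto
  ultimately have "1 / weight a p q \<le> 1 / (real q / real p ^ k * ln (real L) powr (2 - a) * (ln 2 * real (Suc k)) powr a)"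
    by (intro divide_left_mono mult_pos_pos[of "weight a p q"] less_le_trans[OF _ \<open>_ \<le> weight a p q\<close>]) simp_all
  also have "\<dots> = ln (real L) powr (a - 2) * ln 2 powr - a * (real (Suc k) powr - a * (1 / real (q div p ^ k)))"
    unfolding qk using powr_minus_divide[of "ln (real L)" "2 - a"]
    by (simp add: powr_mult powr_minus_divide)
  finally show ?thesis .
qed

lemma sum_inverse_weight_le:
  assumes "prime p" "3 \<le> L" "0 \<le> a" "a < 1"
  shows "(\<Sum>q\<in>{L..<L ^ 3}. 1 / weight a p q) \<le> 4 * ln 2 powr - a * 6 powr (1 - a) / (1 - a)"
proof -
  define n where "n = ln (real L)"
  have "exp 1 \<le> real L" using exp_le assms(2) by linarith
  then have n: "n \<ge> 1" unfolding n_def using assms(2) by (subst ln_ge_iff) auto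
  \<comment> \<open>An exclusive bound for the exponents: \<open>2 ^ k < L ^ 3\<close> and
    \<open>ln 2 \<ge> 2 / 3\<close> give \<open>k < 4.5 * n\<close>. Since \<open>n \<ge> 1\<close>,
    rounding up stays below \<open>6 * n\<close>.\<close>
  define \<kappa> where "\<kappa> = nat \<lceil>5 * n\<rceil>"
  have \<kappa>: "5 * n \<le> real \<kappa>" "real \<kappa> \<le> 6 * n" unfolding \<kappa>_def using n by linarith+
  define v where "v q = multiplicity (int p) (int q)" for q
  define \<phi> where "\<phi> q = (v q, q div p ^ v q)" for q
  define G where "G = (\<lambda>(k, m). real (Suc k) powr - a * (1 / real m))"
  have p: "p \<ge> 2" using assms prime_ge_2_nat by blast
  have decomp: "q = p ^ v q * (q div p ^ v q)" for q
    using power_multiplicity_dvd_nat by (simp add: v_def)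
  have inj: "inj_on \<phi> A" for A
    by (rule inj_onI) (metis \<phi>_def decomp prod.inject)
  have range: "\<phi> ` {L..<L ^ 3} \<subseteq> {..<\<kappa>} \<times> {1..L ^ 3}"
  proof
    fix z assume "z \<in> \<phi> ` {L..<L ^ 3}"
    then obtain q where q: "L \<le> q" "q < L ^ 3" "z = \<phi> q" by auto
    have q0: "q > 0" using q assms(2) by simp
    have "2 ^ v q \<le> p ^ v q" using p by (intro power_mono) auto
    also have "\<dots> \<le> q" using q0 power_multiplicity_dvd_nat by (intro dvd_imp_le) (auto simp: v_def)
    also have "\<dots> < L ^ 3" by fact
    finally have "real (2 ^ v q) < real (L ^ 3)" by (simp only: of_nat_less_iff)
    then have "ln (2 ^ v q) < ln (real L ^ 3)" by (subst ln_less_cancel_iff) (use assms(2) in auto)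
    then have "real (v q) * ln 2 < 3 * n" using assms(2) by (simp add: ln_realpow n_def)
    moreover have "real (v q) * (2 / 3) \<le> real (v q) * ln 2"
      using ln2_ge_two_thirds by (intro mult_left_mono) auto
    ultimately have "real (v q) < real \<kappa>" using \<kappa> n by linarith
    moreover have "q div p ^ v q \<noteq> 0" using decomp[of q] q0 by (metis mult_0_right less_irrefl)
    moreover have "q div p ^ v q \<le> L ^ 3" using q by (meson div_le_dividend less_imp_le order_trans)
    ultimately show "z \<in> {..<\<kappa>} \<times> {1..L ^ 3}" using q(3) by (simp add: \<phi>_def)
  qed
  have "(\<Sum>q\<in>{L..<L ^ 3}. 1 / weight a p q)
      \<le> (\<Sum>q\<in>{L..<L ^ 3}. n powr (a - 2) * ln 2 powr - a * G (\<phi> q))"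
    using inverse_weight_le[OF assms(1,2) _ assms(3,4)]
    by (intro sum_mono) (simp add: G_def \<phi>_def v_def n_def)
  also have "\<dots> = n powr (a - 2) * ln 2 powr - a * (\<Sum>q\<in>{L..<L ^ 3}. G (\<phi> q))"
    by (simp add: sum_distrib_left)
  also have "(\<Sum>q\<in>{L..<L ^ 3}. G (\<phi> q)) = (\<Sum>z\<in>\<phi> ` {L..<L ^ 3}. G z)"
    using sum.reindex[OF inj, of G] by simp
  also have "n powr (a - 2) * ln 2 powr - a * (\<Sum>z\<in>\<phi> ` {L..<L ^ 3}. G z)
      \<le> n powr (a - 2) * ln 2 powr - a * (6 powr (1 - a) * n powr (1 - a) / (1 - a) * (4 * n))"
  proof (rule mult_left_mono)
    \<comment> \<open>All terms are nonnegative, so the image may be enlarged to a full rectangle,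
      over which the sum factors.\<close>
    have "(\<Sum>z\<in>\<phi> ` {L..<L ^ 3}. G z) \<le> (\<Sum>z\<in>{..<\<kappa>} \<times> {1..L ^ 3}. G z)"
      using range by (intro sum_mono2) (auto simp: G_def)
    also have "\<dots> = (\<Sum>k<\<kappa>. real (Suc k) powr - a) * (\<Sum>m = 1..L ^ 3. 1 / real m)"
      unfolding G_def sum_product sum.cartesian_product by simp
    also have "\<dots> \<le> (6 powr (1 - a) * n powr (1 - a) / (1 - a)) * (4 * n)"
    proof (rule mult_mono)
      have "(\<Sum>k<\<kappa>. real (Suc k) powr - a) \<le> real \<kappa> powr (1 - a) / (1 - a)"
        by (rule sum_powr_minus_le[OF assms(3,4)])
      also have "\<dots> \<le> (6 * n) powr (1 - a) / (1 - a)"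
        using \<kappa> assms by (intro divide_right_mono powr_mono2) auto
      finally show "(\<Sum>k<\<kappa>. real (Suc k) powr - a) \<le> 6 powr (1 - a) * n powr (1 - a) / (1 - a)"
        using n by (simp add: powr_mult)
      have "(\<Sum>m = 1..L ^ 3. 1 / real m) \<le> 1 + ln (real (L ^ 3))"
        using assms(2) by (intro sum_inverse_le_ln) simp
      then show "(\<Sum>m = 1..L ^ 3. 1 / real m) \<le> 4 * n"
        using n assms(2) by (simp add: ln_realpow n_def)
    qed (use assms n in \<open>auto intro: sum_nonneg\<close>)
    finally show "(\<Sum>z\<in>\<phi> ` {L..<L ^ 3}. G z) \<le> 6 powr (1 - a) * n powr (1 - a) / (1 - a) * (4 * n)" .
  qed auto
  also have "\<dots> = 4 * ln 2 powr - a * 6 powr (1 - a) / (1 - a) * (n powr (a - 2) * n powr (1 - a) * n powr 1)"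
    using n by simp
  also have "n powr (a - 2) * n powr (1 - a) * n powr 1 = 1"
    using n by (simp flip: powr_add del: powr_one)
  finally show ?thesis by simp
qed

section \<open>The Cantor set attached to the weights, and the dimension\<close>

theorem theorem5:
  fixes a :: real and p :: nat
  assumes "0 \<le> a" and "a < 1" and "prime p"
  shows "hausdorff_dim {\<alpha> :: real.
           liminf (\<lambda>q::nat. ereal (real q * (ln (real q)) powr (2 - a) * dist_nint (real q * \<alpha>)
              * padic_abs p (int q) * (ln (2 / padic_abs p (int q))) powr a)) > 0} = 1"
    (is "hausdorff_dim ?E = 1")
proof -
  define K where "K = 4 * ln 2 powr - a * 6 powr (1 - a) / (1 - a)"
  have K: "K > 0" using assms by (simp add: K_def)
  \<comment> \<open>One factor 16 comes from \<open>card_cells_near_fractions\<close>, the other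
    from the sparsity required by \<open>cantor_tree_avoiding\<close>: at most a sixteenth of the
    grandchildren may be forbidden.\<close>
  define c where "c = 1 / (256 * K)"
  have c: "c > 0" "256 * c * K = 1" using K by (auto simp: c_def)
  have block: "256 * (\<Sum>q\<in>{l..<l ^ 3}. c / weight a p q) \<le> 1" if "l \<ge> 3" for l
  proof -
    have "256 * (\<Sum>q\<in>{l..<l ^ 3}. c / weight a p q) = 256 * c * (\<Sum>q\<in>{l..<l ^ 3}. 1 / weight a p q)"
      by (simp add: sum_distrib_left)
    also have "\<dots> \<le> 256 * c * K"
      unfolding K_def using c sum_inverse_weight_le[OF assms(3) that assms(1,2)] by (intro mult_left_mono) auto
    finally show ?thesis using c(2) by simp
  qed
  have w_pos: "weight a p q > 0" if "q \<ge> 3" for q using weight_pos[OF assms(3) that] .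
  \<comment> \<open>\<open>c / weight a p q\<close> is \<open>q\<close> times the radius around
    \<open>b / q\<close>; its bound 1 is what the cell count requires.\<close>
  have c_w: "c / weight a p q \<le> 1" if q: "q \<ge> 3" for q
  proof -
    have "q < q ^ 3" using q power_strict_increasing[of 1 3 q] by simp
    then have "c / weight a p q \<le> (\<Sum>q\<in>{q..<q ^ 3}. c / weight a p q)"
      using q c less_imp_le[OF w_pos] by (intro member_le_sum) auto
    then show ?thesis using block[OF q] by simp
  qed
  have "eventually (\<lambda>q::nat. 2 * (ln (real q))\<^sup>2 \<le> c * real q) sequentially"
    using c(1) by real_asymp
  then obtain N0 where N0: "\<And>q. q \<ge> N0 \<Longrightarrow> 2 * (ln (real q))\<^sup>2 \<le> c * real q"
    by (auto simp: eventually_sequentially)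
  \<comment> \<open>Evenness makes \<open>(L t)\<^sup>2 div 2\<close> exact, so that passing to the
    next level cubes \<open>L t\<close>.\<close>
  define N where "N = 2 * (N0 + 2)"
  have N: "N \<ge> 3" "N \<ge> N0" "even N" by (auto simp: N_def)
  define L where "L t = N ^ (3 ^ t)" for t :: nat
  define h where "h t = (L t)\<^sup>2 div 2" for t
  have L_ge: "L t \<ge> N" for t
    unfolding L_def using N power_increasing[of 1 "3 ^ t" N] by simp
  have L_cube: "L (Suc t) = L t ^ 3" for t
    by (simp add: L_def power_mult[symmetric] mult.commute)
  have two_h: "2 * h t = (L t)\<^sup>2" for t
    using N(3) by (simp add: h_def L_def)
  have h_pos: "h t > 0" for t using two_h[of t] L_ge[of t] N(1) by (auto intro: gr0I)
  have L_Suc: "L (Suc t) = L t * (2 * h t)" for t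
    by (simp add: two_h L_cube power3_eq_cube power2_eq_square)
  have L_pos: "L t > 0" for t using L_ge[of t] N by simp
  define bad where "bad q l = {j. \<exists>b::int. \<exists>x\<in>cell l j. \<bar>x - real_of_int b / real q\<bar> < c / (real q * weight a p q)}"
    for q l
  \<comment> \<open>Denominators of the block from \<open>L t\<close> to \<open>L (Suc t)\<close>
    are handled by cells of level \<open>Suc (Suc t)\<close>, hence by \<open>X (Suc t)\<close>;
    nothing is forbidden at the first step.\<close>
  define X where "X t = (case t of 0 \<Rightarrow> {} | Suc t \<Rightarrow> (\<Union>q\<in>{L t..<L (Suc t)}. bad q (L (Suc (Suc t)))))" for t
  have X_sparse: "4 * card (X (Suc t) \<inter> {k * (2 * h t * (2 * h (Suc t)))..<Suc k * (2 * h t * (2 * h (Suc t)))})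
      \<le> h t * h (Suc t)" for t k
  proof -
    define M where "M = 2 * h t * (2 * h (Suc t))"
    have M: "L (Suc (Suc t)) = L t * M" "M > 0" using h_pos by (simp_all add: L_Suc M_def)
    have one: "real (card (bad q (L t * M) \<inter> {k * M..<Suc k * M})) \<le> 16 * (c / weight a p q) * real M"
      if q: "q \<in> {L t..<L (Suc t)}" for q
    proof -
      have q': "q \<ge> N" "q \<ge> 3" "q \<ge> N0" using q L_ge[of t] N by auto
      have w: "weight a p q > 0" using w_pos q' by simp
      \<comment> \<open>This is where two generations are needed:
        \<open>q * weight a p q \<le> c * q ^ 3\<close>, and \<open>q ^ 3\<close> is below
        \<open>L (Suc t) ^ 3 = L (Suc (Suc t))\<close>. So the radius is at least the length of a
        cell of level \<open>Suc (Suc t)\<close>.\<close>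
      have "real q * weight a p q \<le> real q * (2 * real q * (ln (real q))\<^sup>2)"
        using weight_le[OF assms(3) q'(2), of a] assms by (intro mult_left_mono) auto
      also have "\<dots> = (real q)\<^sup>2 * (2 * (ln (real q))\<^sup>2)" by (simp add: power2_eq_square)
      also have "\<dots> \<le> (real q)\<^sup>2 * (c * real q)" using N0[OF q'(3)] by (intro mult_left_mono) auto
      also have "\<dots> = c * real q ^ 3" by (simp add: power2_eq_square power3_eq_cube)
      also have "\<dots> \<le> c * real (L (Suc t)) ^ 3" using q c by (intro mult_left_mono power_mono) auto
      also have "\<dots> = c * real (L t * M)" by (simp only: M(1)[symmetric] L_cube[of "Suc t"] of_nat_power)
      finally have "real q * weight a p q \<le> c * real (L t * M)" .
      then have "1 \<le> c / (real q * weight a p q) * real (L t * M)"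
        using w q' by (simp add: field_simps del: of_nat_mult)
      moreover have eq: "real q * (c / (real q * weight a p q)) = c / weight a p q" using q' by simp
      moreover have "bad q (L t * M) \<inter> {k * M..<Suc k * M} = {j \<in> {k * M..<Suc k * M}.
          \<exists>b::int. \<exists>x\<in>cell (L t * M) j. \<bar>x - real_of_int b / real q\<bar> < c / (real q * weight a p q)}"
        by (auto simp: bad_def)
      ultimately show ?thesis
        using card_cells_near_fractions[of "L t" M q "c / (real q * weight a p q)" k] L_pos M(2) q c_w[OF q'(2)]
        by simp
    qed
    have "X (Suc t) \<inter> {k * M..<Suc k * M} = (\<Union>q\<in>{L t..<L (Suc t)}. bad q (L t * M) \<inter> {k * M..<Suc k * M})"
      by (simp add: X_def M(1))
    then have "card (X (Suc t) \<inter> {k * M..<Suc k * M})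
        \<le> (\<Sum>q\<in>{L t..<L (Suc t)}. card (bad q (L t * M) \<inter> {k * M..<Suc k * M}))"
      by (simp only: card_UN_le finite_atLeastLessThan)
    then have "real (card (X (Suc t) \<inter> {k * M..<Suc k * M}))
        \<le> (\<Sum>q\<in>{L t..<L (Suc t)}. real (card (bad q (L t * M) \<inter> {k * M..<Suc k * M})))"
      by (simp only: of_nat_le_iff flip: of_nat_sum)
    also have "\<dots> \<le> (\<Sum>q\<in>{L t..<L (Suc t)}. 16 * (c / weight a p q) * real M)"
      using one by (intro sum_mono)
    also have "\<dots> = 16 * real M * (\<Sum>q\<in>{L t..<L t ^ 3}. c / weight a p q)"
      by (simp add: L_cube sum_distrib_left mult_ac)
    finally have "16 * real (card (X (Suc t) \<inter> {k * M..<Suc k * M}))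
        \<le> real M * (256 * (\<Sum>q\<in>{L t..<L t ^ 3}. c / weight a p q))" by simp
    also have "\<dots> \<le> real M * 1" using block[of "L t"] L_ge[of t] N by (intro mult_left_mono) auto
    finally have "16 * card (X (Suc t) \<inter> {k * M..<Suc k * M}) \<le> M" by simp
    then show ?thesis unfolding M_def by simp
  qed
  obtain ch S where tree: "cantor_tree L h ch S" and avoid: "\<And>t. S (Suc t) \<inter> X t = {}"
    using cantor_tree_avoiding[of L h X] L_pos h_pos L_Suc X_sparse by (auto simp: X_def)
  interpret cantor_tree L h ch S by (rule tree)
  have limit_ge: "c \<le> weight a p q * dist_nint (real q * x)" if x: "x \<in> limit_set" and q: "q \<ge> N" for x q
  proof -
    have "q < 2 ^ q" by (rule less_exp)
    also have "\<dots> \<le> L q" by (rule L_ge_power)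
    finally have ex: "\<exists>n. q < L n" by blast
    define n where "n = (LEAST n. q < L n)"
    have n: "q < L n" unfolding n_def using ex by (rule LeastI_ex)
    \<comment> \<open>\<open>L 0 = N \<le> q\<close>, so \<open>q\<close> falls into one of the
      blocks.\<close>
    have "n \<noteq> 0" using n q by (auto simp: L_def intro: ccontr)
    then obtain t where t: "n = Suc t" using not0_implies_Suc by blast
    have "\<not> q < L t" using not_less_Least[of t "\<lambda>n. q < L n"] t n_def by simp
    then have qt: "q \<in> {L t..<L (Suc t)}" using n t by simp
    obtain j where j: "j \<in> S (Suc (Suc t))" "x \<in> cell (L (Suc (Suc t))) j"
      using x unfolding limit_set_def by blast
    have "j \<notin> X (Suc t)" using avoid[of "Suc t"] j by blast
    then have "j \<notin> bad q (L (Suc (Suc t)))" using qt by (auto simp: X_def)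
    \<comment> \<open>Only the numerator nearest to \<open>q * x\<close> is needed, since it
      realises \<open>dist_nint\<close>.\<close>
    then have far: "c / (real q * weight a p q) \<le> \<bar>x - real_of_int (round (real q * x)) / real q\<bar>"
      using j(2) unfolding bad_def by (auto simp: not_less)
    have q0: "real q > 0" "weight a p q > 0" using q N w_pos by auto
    have "dist_nint (real q * x) = real q * \<bar>x - real_of_int (round (real q * x)) / real q\<bar>"
      using q0 by (simp add: dist_nint_def abs_mult_pos' right_diff_distrib)
    also have "\<dots> \<ge> real q * (c / (real q * weight a p q))" using far q0 by (intro mult_left_mono) auto
    finally show ?thesis using q0 by (simp add: field_simps)
  qed
  have sub: "limit_set \<subseteq> ?E"
  proof
    fix x assume x: "x \<in> limit_set"
    have "ereal c \<le> liminf (\<lambda>q::nat. ereal (real q * (ln (real q)) powr (2 - a) * dist_nint (real q * x)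
              * padic_abs p (int q) * (ln (2 / padic_abs p (int q))) powr a))"
    proof (rule Liminf_bounded)
      show "\<forall>\<^sub>F q in sequentially. ereal c \<le> ereal (real q * (ln (real q)) powr (2 - a) * dist_nint (real q * x)
              * padic_abs p (int q) * (ln (2 / padic_abs p (int q))) powr a)"
        using eventually_ge_at_top[of N]
      proof eventually_elim
        case (elim q)
        then show ?case using limit_ge[OF x, of q] by (simp add: weight_def mult_ac)
      qed
    qed
    moreover have "(0::ereal) < ereal c" using c by simp
    ultimately show "x \<in> ?E" by (simp only: mem_Collect_eq less_le_trans)
  qed
  have nonzero: "hausdorff_measure s ?E \<noteq> 0" if s: "0 < s" "s < 1" for s
  proof -
    \<comment> \<open>Even the logarithm of \<open>L t powr (1 - s)\<close>, which is
      \<open>(1 - s) * 3 ^ t * ln N\<close>, dominates \<open>2 ^ t\<close> up to a constant;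
      \<open>x \<le> exp x\<close> then finishes.\<close>
    have "2 ^ t \<le> 1 / ((1 - s) * ln 2) * real (L t) powr (1 - s)" for t
    proof -
      have "(2::real) ^ t \<le> 3 ^ t" by (intro power_mono) auto
      then have "(1 - s) * ln 2 * 2 ^ t \<le> (1 - s) * ln 2 * 3 ^ t"
        using s by (intro mult_left_mono) auto
      also have "\<dots> \<le> (1 - s) * (3 ^ t * ln (real N))"
        using s N by (simp add: mult.assoc mult_left_mono)
      also have "\<dots> = (1 - s) * ln (real (L t))" using N by (simp add: L_def ln_realpow)
      also have "\<dots> \<le> exp ((1 - s) * ln (real (L t)))"
        using exp_ge_add_one_self[of "(1 - s) * ln (real (L t))"] by linarith
      also have "\<dots> = real (L t) powr (1 - s)" using L_pos[of t] by (simp add: powr_def)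
      finally show ?thesis using s by (simp add: field_simps)
    qed
    then have "hausdorff_measure s limit_set \<noteq> 0" using s by (rule hausdorff_measure_limit_set)
    then show ?thesis using hausdorff_measure_mono[OF sub, of s] by auto
  qed
  show ?thesis
    unfolding hausdorff_dim_def
  proof (rule antisym)
    show "Inf {ereal s |s. s > 0 \<and> hausdorff_measure s ?E = 0} \<le> 1"
    proof (rule ereal_le_epsilon2)
      \<comment> \<open>Vanishing measure was shown for exponents above 1 only, so the bound 1 is
        reached as a limit.\<close>
      fix e :: real assume "0 < e"
      then have "ereal (1 + e) \<in> {ereal s |s. s > 0 \<and> hausdorff_measure s ?E = 0}"
        using hausdorff_measure_real_eq_0[of "1 + e" ?E] by auto
      then show "Inf {ereal s |s. s > 0 \<and> hausdorff_measure s ?E = 0} \<le> 1 + ereal e"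
        by (intro Inf_lower) (simp add: one_ereal_def)
    qed
    show "1 \<le> Inf {ereal s |s. s > 0 \<and> hausdorff_measure s ?E = 0}"
    proof (rule Inf_greatest)
      fix z assume "z \<in> {ereal s |s. s > 0 \<and> hausdorff_measure s ?E = 0}"
      then obtain s where "z = ereal s" "s > 0" "hausdorff_measure s ?E = 0" by blast
      then show "1 \<le> z" using nonzero[of s] by (cases "s < 1") (auto simp: one_ereal_def)
    qed
  qed
qed

end
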